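(* Let $\mathcal{H}=\mathcal{A}\otimes\mathcal{B}$ be a finite dimensional bipartite Hilbert space, and let $\mu$ be any continuous, faithful, non-negative function on the set of pure states of $\mathcal{H}$. Let $f:[0,1]\to[0,\infty)$ be a continuous function that vanishes only at $0$. Then the sequence $(\mu_{f,d})_{d\in\mathbb{N}}$ of $f$-$d$ extensions of $\mu$ detects entanglement; that is, for every density operator $\rho$ on $\mathcal{H}$, $\rho$ is separable if and only if there exists $d\in\mathbb{N}$ such that $\rho\in \mathrm{D}(\mathcal{H})_d$ and $\mu_{f,d}(\rho)=0$.
   Context: All Hilbert spaces are complex and finite dimensional. $\mathrm{D}(\mathcal{H})$ is the set of density operators on $\mathcal{H}$ (positive semidefinite operators of trace $1$). A pure state is a rank-one projection $|\psi\rangle\langle\psi|$ with $\psi\in\mathcal{H}$ a unit vector. A bipartite Hilbert space is $\mathcal{H}=\mathcal{A}\otimes\mathcal{B}$ with $\mathcal{A},\mathcal{B}$ finite dimensional Hilbert spaces. A density operator on $\mathcal{H}$ is separable if it is a convex combination of factorable pure states, i.e. of pure states $|\psi\rangle\langle\psi|$ with $\psi=a\otimes b$, $a\in\mathcal{A}$, $b\in\mathcal{B}$; a pure state is separable exactly when it is factorable. A function $\mu$ from the set of pure states of $\mathcal{H}$ to $[0,\infty)$ is called faithful if, for every pure state $|\psi\rangle\langle\psi|$, $\mu(|\psi\rangle\langle\psi|)=0$ if and only if $|\psi\rangle\langle\psi|$ is separable. Continuity is with respect to the norm topology. For $d\in\mathbb{N}=\{1,2,\dots\}$, $\mathrm{D}(\mathcal{H})_d$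 is the set of $\rho\in \mathrm{D}(\mathcal{H})$ for which there exist pure states $(|\psi_i\rangle\langle\psi_i|)_{i=1}^d$ and numbers $(p_i)_{i=1}^d\subseteq[0,1]$ with $\sum_{i=1}^d p_i=1$ and $\rho=\sum_{i=1}^d p_i|\psi_i\rangle\langle\psi_i|$ (some $p_i$ may be $0$). The $f$-$d$ extension of $\mu$ is the function $\mu_{f,d}:\mathrm{D}(\mathcal{H})_d\to[0,\infty)$, $$\mu_{f,d}(\rho)=\inf\Big\{\sum_{i=1}^d f(p_i)\,\mu(|\psi_i\rangle\langle\psi_i|)\Big\},$$ where the infimum is over all pure states $(|\psi_i\rangle\langle\psi_i|)_{i=1}^d$ and all $(p_i)_{i=1}^d\subseteq[0,1]$ with $\sum_{i=1}^d p_i=1$ and $\rho=\sum_{i=1}^d p_i|\psi_i\rangle\langle\psi_i|$. *)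

theory Defs
  imports "HOL-Analysis.Analysis"
begin

text \<open>A finite dimensional Hilbert space is modelled, up to unitary isomorphism, as
  \<open>complex ^ 'n\<close> with its Hermitian inner product, which induces the library's norm on this
  type, and operators as matrices.  The tensor product of \<open>complex ^ 'a\<close> and \<open>complex ^ 'b\<close> is
  \<open>complex ^ ('a \<times> 'b)\<close>.  The norm of matrices is the Frobenius norm; in finite dimension all
  norms give the same topology.\<close>

type_synonym 'n operator = "complex ^ 'n ^ 'n"

definition cinner :: "complex ^ 'n::finite \<Rightarrow> complex ^ 'n \<Rightarrow> complex" where
  "cinner v w = (\<Sum>i\<in>UNIV. cnj (v $ i) * w $ i)"

text \<open>Over the complex numbers this condition already forces \<open>M\<close> to be Hermitian.\<close>

definition pos_semidef :: "'n::finite operator \<Rightarrow> bool" where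
  "pos_semidef M \<longleftrightarrow> (\<forall>v. cinner v (M *v v) \<in> \<real>\<^sub>\<ge>\<^sub>0)"

definition density_operators :: "'n::finite operator set" where
  "density_operators = {\<rho>. pos_semidef \<rho> \<and> trace \<rho> = 1}"

definition ketbra :: "complex ^ 'n::finite \<Rightarrow> 'n operator" where
  "ketbra \<psi> = (\<chi> i j. \<psi> $ i * cnj (\<psi> $ j))"

definition pure_states :: "'n::finite operator set" where
  "pure_states = {ketbra \<psi> | \<psi>. norm \<psi> = 1}"

definition tensor ::
    "complex ^ 'a::finite \<Rightarrow> complex ^ 'b::finite \<Rightarrow> complex ^ ('a \<times> 'b)" where
  "tensor a b = (\<chi> k. a $ fst k * b $ snd k)"

definition factorable_pure_states :: "('a::finite \<times> 'b::finite) operator set" where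
  "factorable_pure_states = {ketbra (tensor a b) | a b. norm (tensor a b) = 1}"

definition separable :: "('a::finite \<times> 'b::finite) operator \<Rightarrow> bool" where
  "separable \<rho> \<longleftrightarrow> \<rho> \<in> density_operators \<and> \<rho> \<in> convex hull factorable_pure_states"

definition faithful :: "(('a::finite \<times> 'b::finite) operator \<Rightarrow> real) \<Rightarrow> bool" where
  "faithful \<mu> \<longleftrightarrow> (\<forall>P\<in>pure_states. \<mu> P = 0 \<longleftrightarrow> separable P)"

definition pure_decomposition ::
    "nat \<Rightarrow> (nat \<Rightarrow> real) \<Rightarrow> (nat \<Rightarrow> 'n::finite operator) \<Rightarrow> 'n::finite operator \<Rightarrow> bool" where
  "pure_decomposition d p P \<rho> \<longleftrightarrow>
     (\<forall>i\<in>{1..d}. P i \<in> pure_states \<and> p i \<in> {0..1}) \<and>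
     (\<Sum>i=1..d. p i) = 1 \<and>
     \<rho> = (\<Sum>i=1..d. p i *\<^sub>R P i)"

definition density_operators_of_length :: "nat \<Rightarrow> 'n::finite operator set" where
  "density_operators_of_length d =
     {\<rho> \<in> density_operators. \<exists>p P. pure_decomposition d p P \<rho>}"

text \<open>Only meaningful for \<open>\<rho> \<in> density_operators_of_length d\<close>: otherwise the infimum is
  taken over the empty set and its value is arbitrary.\<close>

definition fd_extension ::
    "('n::finite operator \<Rightarrow> real) \<Rightarrow> (real \<Rightarrow> real) \<Rightarrow> nat \<Rightarrow> 'n operator \<Rightarrow> real" where
  "fd_extension \<mu> f d \<rho> =
     Inf {(\<Sum>i=1..d. f (p i) * \<mu> (P i)) | p P. pure_decomposition d p P \<rho>}"

text \<open>\<open>E d\<close> is regarded as a function on \<open>density_operators_of_length d\<close>, for \<open>d \<ge> 1\<close>.\<close>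

definition detects_entanglement ::
    "(nat \<Rightarrow> ('a::finite \<times> 'b::finite) operator \<Rightarrow> real) \<Rightarrow> bool" where
  "detects_entanglement E \<longleftrightarrow>
     (\<forall>\<rho>\<in>density_operators. separable \<rho> \<longleftrightarrow>
        (\<exists>d\<ge>1. \<rho> \<in> density_operators_of_length d \<and> E d \<rho> = 0))"

end

theory Submission imports Defs begin

text \<open>For fixed \<open>d\<close> the decompositions of \<open>\<rho>\<close> into \<open>d\<close> pure states form a compact set, on
  which the cost \<open>\<Sum>i. f (p i) * \<mu> (P i)\<close> is continuous, so the infimum is attained.  At a
  minimiser of cost \<open>0\<close> every \<open>P i\<close> of nonzero weight satisfies \<open>\<mu> (P i) = 0\<close> and is separable,
  hence so is \<open>\<rho>\<close>.\<close>

text \<open>The quadratic form of \<open>ketbra \<psi>\<close> at \<open>v\<close> is the squared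
  modulus of \<open>cinner v \<psi>\<close>, and its trace is the square of
  \<open>norm \<psi>\<close>.\<close>

lemma ketbra_density_operator:
  assumes "norm \<psi> = 1"
  shows "ketbra \<psi> \<in> density_operators"
proof -
  have "cinner v (ketbra \<psi> *v v) = cinner v \<psi> * cnj (cinner v \<psi>)" for v
    unfolding cinner_def ketbra_def matrix_vector_mult_def
    by (simp, subst sum_product) (simp add: sum_distrib_left mult_ac)
  then have "pos_semidef (ketbra \<psi>)"
    unfolding pos_semidef_def complex_norm_square[symmetric] by simp
  moreover have "trace (ketbra \<psi>) = of_real ((norm \<psi>)\<^sup>2)"
    unfolding trace_def ketbra_def norm_vec_def L2_set_def
    by (simp add: sum_nonneg complex_norm_square[symmetric])
  ultimately show ?thesis
    using assms by (simp add: density_operators_def)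
qed

lemma factorable_pure_states_subset: "factorable_pure_states \<subseteq> pure_states"
  by (auto simp: factorable_pure_states_def pure_states_def)

lemma separable_factorable_pure_state:
  assumes "P \<in> factorable_pure_states"
  shows "separable P"
  using assms ketbra_density_operator hull_inc[OF assms, of convex]
  by (auto simp: separable_def factorable_pure_states_def)

lemma compact_pure_states: "compact (pure_states :: 'n::finite operator set)"
proof -
  have "pure_states = ketbra ` sphere (0 :: complex ^ 'n) 1"
    by (auto simp: pure_states_def)
  moreover have "continuous_on (sphere 0 1) (ketbra :: complex ^ 'n \<Rightarrow> 'n operator)"
    unfolding ketbra_def by (intro continuous_intros)
  ultimately show ?thesis
    by (metis compact_continuous_image compact_sphere)
qed

text \<open>Tychonoff's theorem, carried over to the topology of the function type, which is the
  product topology.\<close>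

lemma compact_PiE_UNIV:
  fixes K :: "'b::topological_space set"
  assumes "compact K"
  shows "compact (Pi\<^sub>E (UNIV :: 'i set) (\<lambda>_. K))"
proof -
  have "compactin (product_topology (\<lambda>_. euclidean) UNIV) (Pi\<^sub>E (UNIV :: 'i set) (\<lambda>_. K))"
    using assms by (subst compactin_PiE) auto
  then show ?thesis
    by (simp add: euclidean_product_topology)
qed

lemma fd_extension_attained:
  fixes \<mu> :: "'n::finite operator \<Rightarrow> real"
  assumes \<mu>: "continuous_on pure_states \<mu>"
    and f: "continuous_on {0..1} f"
    and ex: "pure_decomposition d p\<^sub>0 P\<^sub>0 \<rho>"
  obtains p P where "pure_decomposition d p P \<rho>"
    and "fd_extension \<mu> f d \<rho> = (\<Sum>i=1..d. f (p i) * \<mu> (P i))"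
proof -
  \<comment> \<open>\<open>pure_decomposition\<close> says nothing about indices outside
    \<open>{1..d}\<close>. Here every coordinate is confined to a compact set, so that the whole
    space of sequences is compact.\<close>
  define K where "K = Pi\<^sub>E (UNIV :: nat set) (\<lambda>_. {0..1::real} \<times> (pure_states :: 'n operator set))"
  define C where "C = {z \<in> K. (\<Sum>i=1..d. fst (z i)) = 1 \<and> (\<Sum>i=1..d. fst (z i) *\<^sub>R snd (z i)) = \<rho>}"
  define F where "F z = (\<Sum>i=1..d. f (fst (z i)) * \<mu> (snd (z i)))" for z
  have "compact K"
    unfolding K_def by (intro compact_PiE_UNIV compact_Times compact_pure_states compact_Icc)
  have coord: "continuous_on S (\<lambda>z :: nat \<Rightarrow> real \<times> 'n operator. z i)" for S i
    by (rule continuous_on_subset[OF continuous_on_product_coordinates]) simp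
  have "closed {z :: nat \<Rightarrow> real \<times> 'n operator.
      (\<Sum>i=1..d. fst (z i)) = 1 \<and> (\<Sum>i=1..d. fst (z i) *\<^sub>R snd (z i)) = \<rho>}"
    by (intro closed_Collect_conj closed_Collect_eq continuous_intros coord)
  then have "compact C"
    using \<open>compact K\<close> compact_Int_closed unfolding C_def Collect_conj_eq Collect_mem_eq by blast
  have inK: "fst (z i) \<in> {0..1}" "snd (z i) \<in> pure_states" if "z \<in> C" for z i
    using that by (auto simp: C_def K_def PiE_def Pi_def mem_Times_iff)
  \<comment> \<open>\<open>f\<close> and \<open>\<mu>\<close> are continuous only on
    \<open>{0..1}\<close> and \<open>pure_states\<close>; by \<open>inK\<close> the coordinates of
    points of \<open>C\<close> stay there.\<close>
  have "continuous_on C F"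
    unfolding F_def using inK
    by (intro continuous_intros continuous_on_compose2[OF f] continuous_on_compose2[OF \<mu>] coord) auto
  have dec: "pure_decomposition d (\<lambda>i. fst (z i)) (\<lambda>i. snd (z i)) \<rho>" if "z \<in> C" for z
    using that inK[OF that] by (auto simp: pure_decomposition_def C_def)
  \<comment> \<open>Minimising over \<open>C\<close> misses no cost: each decomposition agrees on
    \<open>{1..d}\<close> with a point of \<open>C\<close>.\<close>
  have lift: "\<exists>z\<in>C. F z = (\<Sum>i=1..d. f (p i) * \<mu> (P i))" if pd: "pure_decomposition d p P \<rho>" for p P
  proof -
    have "d \<ge> 1"
      using pd by (cases d) (auto simp: pure_decomposition_def)
    \<comment> \<open>Indices outside \<open>{1..d}\<close> repeat the first entry, which is a
      legitimate pair because \<open>d \<ge> 1\<close>; so \<open>z\<close> lies in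
      \<open>K\<close>.\<close>
    define z where "z i = (let j = if i \<in> {1..d} then i else 1 in (p j, P j))" for i
    have z: "z i = (p i, P i)" if "i \<in> {1..d}" for i
      using that by (simp add: z_def)
    have "z \<in> K"
      using pd \<open>d \<ge> 1\<close> by (auto simp: K_def z_def Let_def pure_decomposition_def)
    then have "z \<in> C"
      using pd by (simp add: C_def pure_decomposition_def z)
    moreover have "F z = (\<Sum>i=1..d. f (p i) * \<mu> (P i))"
      by (simp add: F_def z)
    ultimately show ?thesis
      by blast
  qed
  have "C \<noteq> {}"
    using lift[OF ex] by blast
  then obtain z where z: "z \<in> C" "\<And>y. y \<in> C \<Longrightarrow> F z \<le> F y"
    using continuous_attains_inf[OF \<open>compact C\<close> _ \<open>continuous_on C F\<close>] by blast
  have "fd_extension \<mu> f d \<rho> = F z"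
    unfolding fd_extension_def
  proof (rule cInf_eq_minimum)
    show "F z \<in> {\<Sum>i=1..d. f (p i) * \<mu> (P i) |p P. pure_decomposition d p P \<rho>}"
      unfolding F_def
      by (intro CollectI exI[of _ "\<lambda>i. fst (z i)"] exI[of _ "\<lambda>i. snd (z i)"] conjI refl dec z(1))
    show "F z \<le> x" if "x \<in> {\<Sum>i=1..d. f (p i) * \<mu> (P i) |p P. pure_decomposition d p P \<rho>}" for x
      using that lift z(2) by fastforce
  qed
  then show thesis
    using that dec[OF z(1)] by (simp add: F_def)
qed

text \<open>Terms of weight zero contribute neither to the total weight nor to the operator.
  Dropping them leaves a convex combination of points of the hull, which is convex.\<close>

lemma pure_decomposition_in_convex_hull:
  assumes "pure_decomposition d p P \<rho>"
    and "\<And>i. i \<in> {1..d} \<Longrightarrow> p i \<noteq> 0 \<Longrightarrow> P i \<in> convex hull S"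
  shows "\<rho> \<in> convex hull S"
proof -
  define I where "I = {i \<in> {1..d}. p i \<noteq> 0}"
  have "(\<Sum>i\<in>I. p i) = (\<Sum>i=1..d. p i)" "(\<Sum>i\<in>I. p i *\<^sub>R P i) = (\<Sum>i=1..d. p i *\<^sub>R P i)"
    by (auto simp: I_def intro!: sum.mono_neutral_left)
  moreover have "(\<Sum>i\<in>I. p i *\<^sub>R P i) \<in> convex hull S" if "(\<Sum>i\<in>I. p i) = 1"
    using that assms by (intro convex_sum) (auto simp: I_def pure_decomposition_def)
  ultimately show ?thesis
    using assms(1) by (simp add: pure_decomposition_def)
qed

text \<open>The length \<open>d\<close> is that of some finite convex combination witnessing
  membership in the hull.\<close>

lemma separable_decomposition:
  fixes \<rho> :: "('a::finite \<times> 'b::finite) operator"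
  assumes "separable \<rho>"
  obtains d p and P :: "nat \<Rightarrow> ('a \<times> 'b) operator" where "d \<ge> 1" "pure_decomposition d p P \<rho>"
    "\<And>i. i \<in> {1..d} \<Longrightarrow> P i \<in> factorable_pure_states"
proof -
  have "\<rho> \<in> convex hull factorable_pure_states"
    using assms by (simp add: separable_def)
  then obtain d p and P :: "nat \<Rightarrow> ('a \<times> 'b) operator"
    where *: "\<forall>i\<in>{1..d}. 0 \<le> p i \<and> P i \<in> factorable_pure_states"
      "sum p {1..d} = 1" "(\<Sum>i=1..d. p i *\<^sub>R P i) = \<rho>"
    unfolding convex_hull_indexed mem_Collect_eq by (elim exE conjE)
  \<comment> \<open>The hull provides only nonnegative weights; each is at most their sum, which is
    1.\<close>
  have "p i \<le> 1" if "i \<in> {1..d}" for i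
    using member_le_sum[of i "{1..d}" p] that * by auto
  then have "pure_decomposition d p P \<rho>"
    using * factorable_pure_states_subset by (auto simp: pure_decomposition_def)
  moreover have "d \<ge> 1"
    using *(2) by (cases d) auto
  ultimately show thesis
    using that * by blast
qed

theorem proposition1p8:
  fixes \<mu> :: "('a::finite \<times> 'b::finite) operator \<Rightarrow> real"
    and f :: "real \<Rightarrow> real"
  assumes "continuous_on pure_states \<mu>"
    and "\<And>P. P \<in> pure_states \<Longrightarrow> \<mu> P \<ge> 0"
    and "faithful \<mu>"
    and "continuous_on {0..1} f"
    and "\<And>x. x \<in> {0..1} \<Longrightarrow> f x \<ge> 0"
    and "\<And>x. x \<in> {0..1} \<Longrightarrow> f x = 0 \<longleftrightarrow> x = 0"
  shows "detects_entanglement (fd_extension \<mu> f)"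
  unfolding detects_entanglement_def
proof (intro ballI iffI)
  have nonneg: "f (p i) * \<mu> (P i) \<ge> 0" if "pure_decomposition d p P \<rho>" "i \<in> {1..d}" for d p P \<rho> i
    using that assms(2,5) by (simp add: pure_decomposition_def)
  fix \<rho> :: "('a \<times> 'b) operator"
  assume \<rho>: "\<rho> \<in> density_operators"
  {
    assume "separable \<rho>"
    then obtain d p P where d: "d \<ge> 1" and pd: "pure_decomposition d p P \<rho>"
      and fac: "\<And>i. i \<in> {1..d} \<Longrightarrow> P i \<in> factorable_pure_states"
      by (rule separable_decomposition) blast
    have "\<mu> (P i) = 0" if "i \<in> {1..d}" for i
      using fac[OF that] assms(3) separable_factorable_pure_state factorable_pure_states_subset
      by (auto simp: faithful_def)
    then have cost: "(\<Sum>i=1..d. f (p i) * \<mu> (P i)) = 0"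
      by simp
    \<comment> \<open>All costs are nonnegative, and the factorable decomposition attains 0.\<close>
    have "fd_extension \<mu> f d \<rho> = 0"
      unfolding fd_extension_def
    proof (rule cInf_eq_minimum)
      show "0 \<in> {\<Sum>i=1..d. f (p i) * \<mu> (P i) |p P. pure_decomposition d p P \<rho>}"
        using pd cost by force
      show "0 \<le> x" if "x \<in> {\<Sum>i=1..d. f (p i) * \<mu> (P i) |p P. pure_decomposition d p P \<rho>}" for x
        using that nonneg by (auto intro!: sum_nonneg)
    qed
    then show "\<exists>d\<ge>1. \<rho> \<in> density_operators_of_length d \<and> fd_extension \<mu> f d \<rho> = 0"
      using d pd \<rho> by (auto simp: density_operators_of_length_def)
  next
    assume "\<exists>d\<ge>1. \<rho> \<in> density_operators_of_length d \<and> fd_extension \<mu> f d \<rho> = 0"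
    then obtain d p\<^sub>0 P\<^sub>0 where "pure_decomposition d p\<^sub>0 P\<^sub>0 \<rho>" and "fd_extension \<mu> f d \<rho> = 0"
      by (auto simp: density_operators_of_length_def)
    \<comment> \<open>Attainment is what matters here: an infimum of 0 by itself gives only
      decompositions of arbitrarily small cost.\<close>
    then obtain p P where pd: "pure_decomposition d p P \<rho>"
      and "(\<Sum>i=1..d. f (p i) * \<mu> (P i)) = 0"
      using fd_extension_attained[OF assms(1,4)] by metis
    then have cost: "\<forall>i\<in>{1..d}. f (p i) * \<mu> (P i) = 0"
      using sum_nonneg_eq_0_iff[of "{1..d}" "\<lambda>i. f (p i) * \<mu> (P i)"] nonneg[OF pd] by blast
    have "P i \<in> convex hull factorable_pure_states" if "i \<in> {1..d}" "p i \<noteq> 0" for i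
    proof -
      have "p i \<in> {0..1}" "P i \<in> pure_states"
        using pd that by (auto simp: pure_decomposition_def)
      \<comment> \<open>Since \<open>f\<close> vanishes only at 0, the nonzero weight gives
        \<open>f (p i) \<noteq> 0\<close>, so the other factor of the zero product vanishes.
        Faithfulness then makes \<open>P i\<close> separable.\<close>
      then have "\<mu> (P i) = 0"
        using cost that assms(6)[of "p i"] by auto
      then show ?thesis
        using \<open>P i \<in> pure_states\<close> assms(3) by (auto simp: faithful_def separable_def)
    qed
    then show "separable \<rho>"
      using \<rho> pure_decomposition_in_convex_hull[OF pd] by (simp add: separable_def)
  }
qed

end
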